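(* Let $X$ be a real Banach space, $x\in S_X$, $x^*\in D(x)$ and $\alpha>0$. If $x$ is a Daugavet-point relative to the supporting slice $S:=S(x^*,\alpha)$, then $\|x-z\|=2$ for every denting point $z$ of $B_X$ that belongs to $S$.
   Context: All Banach spaces are real. $B_X$ and $S_X$ denote the closed unit ball and unit sphere of $X$. A slice of $B_X$ is a set of the form $S(x^*,\alpha)=\{y\in B_X:\ x^*(y)>\sup x^*(B_X)-\alpha\}$ with $x^*\in X^*$ and $\alpha>0$. For $x\in S_X$ let $D(x)=\{x^*\in S_{X^*}:\ x^*(x)=1\}$; a supporting slice at $x$ is a slice $S(x^*,\alpha)$ with $x^*\in D(x)$ and $\alpha>0$. A point $x\in S_X$ is a Daugavet-point relative to a supporting slice $S$ at $x$ if $\sup_{y\in T}\|x-y\|=2$ for every slice $T$ of $B_X$ with $T\subseteq S$. A point $z\in B_X$ is a denting point of $B_X$ if it is contained in slices of $B_X$ of arbitrarily small diameter. *)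

theory Defs
  imports "HOL-Analysis.Analysis"
begin

text \<open>The dual of a real Banach space \<open>'a\<close> is the type \<open>'a \<Rightarrow>\<^sub>L real\<close> with the operator norm.
  The zero functional is admitted in a slice, which is then the whole unit ball.\<close>

definition slice :: "('a::banach \<Rightarrow>\<^sub>L real) \<Rightarrow> real \<Rightarrow> 'a set" where
  "slice f \<alpha> =
     {y \<in> cball 0 1. blinfun_apply f y > (SUP u\<in>cball 0 1. blinfun_apply f u) - \<alpha>}"

definition is_slice :: "'a::banach set \<Rightarrow> bool" where
  "is_slice T \<longleftrightarrow> (\<exists>f \<alpha>. \<alpha> > 0 \<and> T = slice f \<alpha>)"

definition supporting_functionals :: "'a::banach \<Rightarrow> ('a \<Rightarrow>\<^sub>L real) set" where
  "supporting_functionals x = {f \<in> sphere 0 1. blinfun_apply f x = 1}"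

definition supporting_slice :: "'a::banach \<Rightarrow> 'a set \<Rightarrow> bool" where
  "supporting_slice x S \<longleftrightarrow>
     (\<exists>f\<in>supporting_functionals x. \<exists>\<alpha>>0. S = slice f \<alpha>)"

definition Daugavet_point_relative :: "'a::banach \<Rightarrow> 'a set \<Rightarrow> bool" where
  "Daugavet_point_relative x S \<longleftrightarrow>
     x \<in> sphere 0 1 \<and> supporting_slice x S \<and>
     (\<forall>T. is_slice T \<and> T \<subseteq> S \<longrightarrow> (SUP y\<in>T. norm (x - y)) = 2)"

definition denting_point :: "'a::banach \<Rightarrow> bool" where
  "denting_point z \<longleftrightarrow>
     z \<in> cball 0 1 \<and> (\<forall>\<epsilon>>0. \<exists>T. is_slice T \<and> z \<in> T \<and> diameter T < \<epsilon>)"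

end

theory Submission
  imports Defs
begin

text \<open>A slice through \<open>z\<close> of small enough diameter already lies inside the slice \<open>slice f \<alpha>\<close>:
  the strict inequality defining membership of \<open>z\<close> leaves a margin, and \<open>f\<close>, being
  1-Lipschitz, cannot use it up over a set of smaller diameter.  So a denting point \<open>z\<close> of
  \<open>slice f \<alpha>\<close> lies in arbitrarily small slices \<open>T\<close> to which the Daugavet condition applies.
  Such a \<open>T\<close> contains a point at distance almost 2 from \<open>x\<close>, and that point is close to \<open>z\<close>.\<close>

lemma bounded_is_slice: "is_slice T \<Longrightarrow> bounded T"
  by (rule bounded_subset[OF bounded_cball[of 0 1]]) (auto simp: is_slice_def slice_def)

lemma small_slice_through_point_subset_slice:
  fixes f :: "'a::banach \<Rightarrow>\<^sub>L real"
  assumes f: "norm f \<le> 1"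
    and T: "is_slice T" and zT: "z \<in> T"
    and diam: "diameter T < f z - ((SUP u\<in>cball 0 1. f u) - \<alpha>)"
  shows "T \<subseteq> slice f \<alpha>"
proof
  fix y assume y: "y \<in> T"
  have "f z - f y \<le> norm (f (z - y))"
    by (simp add: blinfun.diff_right)
  also have "\<dots> \<le> norm f * norm (z - y)"
    by (rule norm_blinfun)
  also have "\<dots> \<le> dist z y"
    using f by (simp add: dist_norm mult_left_le_one_le)
  also have "\<dots> \<le> diameter T"
    using diameter_bounded_bound[OF bounded_is_slice[OF T] zT y] .
  finally have "f y > (SUP u\<in>cball 0 1. f u) - \<alpha>"
    using diam by linarith
  moreover have "y \<in> cball 0 1"
    using T y by (auto simp: is_slice_def slice_def)
  ultimately show "y \<in> slice f \<alpha>"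
    by (simp add: slice_def)
qed

theorem proposition3p5:
  fixes x :: "'a::banach" and f :: "'a \<Rightarrow>\<^sub>L real" and \<alpha> :: real
  assumes "x \<in> sphere 0 1"
    and "f \<in> supporting_functionals x"
    and "\<alpha> > 0"
    and "Daugavet_point_relative x (slice f \<alpha>)"
  shows "\<forall>z. denting_point z \<and> z \<in> slice f \<alpha> \<longrightarrow> norm (x - z) = 2"
proof (intro allI impI, elim conjE)
  fix z assume dent: "denting_point z" and zS: "z \<in> slice f \<alpha>"
  let ?margin = "f z - ((SUP u\<in>cball 0 1. f u) - \<alpha>)"
  have margin: "?margin > 0"
    using zS by (simp add: slice_def)
  have "2 \<le> norm (x - z) + e" if e: "e > 0" for e
  proof -
    obtain T where T: "is_slice T" "z \<in> T" and diam: "diameter T < min e ?margin"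
      using dent e margin unfolding denting_point_def by (metis min_less_iff_conj)
    have "T \<subseteq> slice f \<alpha>"
      using small_slice_through_point_subset_slice[of f T z \<alpha>] assms(2) T diam
      by (simp add: supporting_functionals_def)
    then have sup: "(SUP y\<in>T. norm (x - y)) = 2"
      using assms(4) T by (simp add: Daugavet_point_relative_def)
    have "norm (x - y) \<le> norm (x - z) + e" if y: "y \<in> T" for y
    proof -
      have "dist z y \<le> e"
        using diameter_bounded_bound[OF bounded_is_slice[OF T(1)] T(2) y] diam by simp
      then show ?thesis
        using dist_triangle[of x y z] by (simp add: dist_norm)
    qed
    then have "(SUP y\<in>T. norm (x - y)) \<le> norm (x - z) + e"
      using T(2) by (intro cSUP_least) auto
    then show ?thesis
      using sup by simp
  qed
  then have "2 \<le> norm (x - z)"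
    by (rule field_le_epsilon)
  moreover have "norm (x - z) \<le> 2"
    using norm_triangle_ineq4[of x z] assms(1) dent by (simp add: denting_point_def)
  ultimately show "norm (x - z) = 2"
    by simp
qed

end
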